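(* Let $n$ be a truncation level, let $X\to Y$ be a morphism in $\mathcal{S}_\pi$, and let $X\to Z\to Y$ be its factorization, computed in $\mathcal{S}$, into an $n$-connected map followed by an $n$-truncated map. Then the space $Z$ is $\pi$-finite.
   Context: "Category" means $(\infty,1)$-category. $\mathcal{S}$ is the category of spaces ($\infty$-groupoids). A space $X$ is $\pi$-finite if $\pi_0(X)$ is a finite set, all $\pi_n(X,x)$ ($n>0$) are finite groups for every choice of base point $x$, and $X$ is $n$-truncated for some $n$. $\mathcal{S}_\pi\subset\mathcal{S}$ is the full subcategory of $\pi$-finite spaces. The factorization is the usual fiberwise Postnikov one: the fiber of $Z\to Y$ over a point is the $n$-truncation of the fiber of $X\to Y$. *)

theory Defs
  imports "HOL-Analysis.Analysis"
begin

text \<open>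
  Spaces are modelled by topological spaces up to weak homotopy equivalence, with no restriction
  to CW complexes. Homotopy fibers, and the predicates below on spaces and on maps, are invariant
  under weak equivalence, so a diagram of infinity-groupoids may be represented by any diagram of
  topological spaces and continuous maps that presents it.
\<close>

subsection \<open>Homotopy groups\<close>

definition cube :: "nat \<Rightarrow> (nat \<Rightarrow> real) topology" where
  "cube n = product_topology (\<lambda>_. top_of_set {0..1}) {..<n}"

definition cube_boundary :: "nat \<Rightarrow> (nat \<Rightarrow> real) set" where
  "cube_boundary n = {t \<in> topspace (cube n). \<exists>i<n. t i = 0 \<or> t i = 1}"

definition maps_rel_boundary :: "nat \<Rightarrow> 'a topology \<Rightarrow> 'a \<Rightarrow> ((nat \<Rightarrow> real) \<Rightarrow> 'a) set" where
  "maps_rel_boundary n X x =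
     {g. continuous_map (cube n) X g \<and> (\<forall>t\<in>cube_boundary n. g t = x)}"

definition homotopy_rel_boundary ::
    "nat \<Rightarrow> 'a topology \<Rightarrow> 'a \<Rightarrow> (((nat \<Rightarrow> real) \<Rightarrow> 'a) \<times> ((nat \<Rightarrow> real) \<Rightarrow> 'a)) set" where
  "homotopy_rel_boundary n X x =
     {(g, h). homotopic_with (\<lambda>u. \<forall>t\<in>cube_boundary n. u t = x) (cube n) X g h}"

text \<open>
  The underlying set of the homotopy group of \<open>X\<close> at \<open>x\<close> in degree \<open>n\<close>; only used for \<open>n > 0\<close>.
  The functions in a class are unconstrained outside the cube. This does not affect the quotient,
  since \<^const>\<open>homotopic_with\<close> identifies functions that agree on the cube.
\<close>

definition homotopy_group :: "nat \<Rightarrow> 'a topology \<Rightarrow> 'a \<Rightarrow> ((nat \<Rightarrow> real) \<Rightarrow> 'a) set set" where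
  "homotopy_group n X x = maps_rel_boundary n X x // homotopy_rel_boundary n X x"

lemma equiv_homotopy_rel_boundary:
  "equiv (maps_rel_boundary n X x) (homotopy_rel_boundary n X x)"
proof (rule equivI)
  show "homotopy_rel_boundary n X x \<subseteq> maps_rel_boundary n X x \<times> maps_rel_boundary n X x"
    unfolding homotopy_rel_boundary_def maps_rel_boundary_def
    by (auto dest: homotopic_with_imp_continuous_maps homotopic_with_imp_property)
  show "refl_on (maps_rel_boundary n X x) (homotopy_rel_boundary n X x)"
    unfolding refl_on_def homotopy_rel_boundary_def maps_rel_boundary_def by auto
  show "sym (homotopy_rel_boundary n X x)"
    unfolding sym_def homotopy_rel_boundary_def by (auto intro: homotopic_with_symD)
  show "trans (homotopy_rel_boundary n X x)"
    unfolding trans_def homotopy_rel_boundary_def by (auto intro: homotopic_with_trans)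
qed

subsection \<open>Truncated, connected and \<open>\<pi>\<close>-finite spaces\<close>

text \<open>
  The level \<open>k\<close> is an integer with \<open>k \<ge> -2\<close>. A space is \<open>(-2)\<close>-truncated if it is weakly
  contractible and \<open>(-1)\<close>-truncated if it is empty or weakly contractible; the empty space counts
  as \<^const>\<open>path_connected_space\<close>. A space is \<open>k\<close>-connected if its \<open>k\<close>-truncation is
  contractible, so every space is \<open>(-2)\<close>-connected and the \<open>(-1)\<close>-connected spaces are the
  nonempty ones.
\<close>

definition truncated_space :: "int \<Rightarrow> 'a topology \<Rightarrow> bool" where
  "truncated_space k X \<longleftrightarrow>
     (k < -1 \<longrightarrow> topspace X \<noteq> {}) \<and>
     (k < 0 \<longrightarrow> path_connected_space X) \<and>
     (\<forall>i>0. int i > k \<longrightarrow> (\<forall>x\<in>topspace X. is_singleton (homotopy_group i X x)))"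

definition connected_space_at_level :: "int \<Rightarrow> 'a topology \<Rightarrow> bool" where
  "connected_space_at_level k X \<longleftrightarrow>
     (k \<ge> -1 \<longrightarrow> topspace X \<noteq> {}) \<and>
     (k \<ge> 0 \<longrightarrow> path_connected_space X) \<and>
     (\<forall>i>0. int i \<le> k \<longrightarrow> (\<forall>x\<in>topspace X. is_singleton (homotopy_group i X x)))"

definition pi_finite :: "'a topology \<Rightarrow> bool" where
  "pi_finite X \<longleftrightarrow>
     finite (path_components_of X) \<and>
     (\<forall>i>0. \<forall>x\<in>topspace X. finite (homotopy_group i X x)) \<and>
     (\<exists>k\<ge>-2. truncated_space k X)"

subsection \<open>Homotopy fibers, truncated and connected maps\<close>

text \<open>
  The compact-open topology on the continuous maps, each represented by its extensional version.
\<close>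

definition mapping_space :: "'a topology \<Rightarrow> 'b topology \<Rightarrow> ('a \<Rightarrow> 'b) topology" where
  "mapping_space X Y = topology_generated_by
     {{g \<in> extensional (topspace X). continuous_map X Y g \<and> g ` K \<subseteq> U} | K U.
        compactin X K \<and> openin Y U}"

lemma topspace_mapping_space:
  "topspace (mapping_space X Y) = {g \<in> extensional (topspace X). continuous_map X Y g}"
proof -
  have "compactin X {}" "openin Y {}" by auto
  then show ?thesis
    unfolding mapping_space_def topology_generated_by_topspace by blast
qed

definition homotopy_fiber ::
    "'a topology \<Rightarrow> 'b topology \<Rightarrow> ('a \<Rightarrow> 'b) \<Rightarrow> 'b \<Rightarrow> ('a \<times> (real \<Rightarrow> 'b)) topology" where
  "homotopy_fiber X Y f y =
     subtopology (prod_topology X (mapping_space (top_of_set {0..1}) Y))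
       {(x, \<gamma>). \<gamma> 0 = f x \<and> \<gamma> 1 = y}"

definition truncated_map :: "int \<Rightarrow> 'a topology \<Rightarrow> 'b topology \<Rightarrow> ('a \<Rightarrow> 'b) \<Rightarrow> bool" where
  "truncated_map k X Y f \<longleftrightarrow>
     continuous_map X Y f \<and> (\<forall>y\<in>topspace Y. truncated_space k (homotopy_fiber X Y f y))"

definition connected_map_at_level :: "int \<Rightarrow> 'a topology \<Rightarrow> 'b topology \<Rightarrow> ('a \<Rightarrow> 'b) \<Rightarrow> bool" where
  "connected_map_at_level k X Y f \<longleftrightarrow>
     continuous_map X Y f \<and> (\<forall>y\<in>topspace Y. connected_space_at_level k (homotopy_fiber X Y f y))"

text \<open>
  A factorization \<open>X \<rightarrow> Z \<rightarrow> Y\<close> of \<open>f\<close> in the infinity-category of spaces: the triangle commutes up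
  to homotopy.
\<close>

definition connected_truncated_factorization ::
    "int \<Rightarrow> 'a topology \<Rightarrow> 'c topology \<Rightarrow> 'b topology \<Rightarrow> ('a \<Rightarrow> 'b) \<Rightarrow> ('a \<Rightarrow> 'c) \<Rightarrow> ('c \<Rightarrow> 'b) \<Rightarrow> bool" where
  "connected_truncated_factorization k X Z Y f p q \<longleftrightarrow>
     connected_map_at_level k X Z p \<and> truncated_map k Z Y q \<and>
     homotopic_with (\<lambda>_. True) X Y (q \<circ> p) f"

end

theory Submission
  imports Defs
begin

text \<open>
  The long exact sequences of \<open>p\<close> and \<open>q\<close> bound the homotopy of \<open>Z\<close>. In degrees \<open>i > n\<close> the
  fibers of \<open>q\<close> have trivial \<open>\<pi>\<^sub>i\<close>, so \<open>\<pi>\<^sub>i Z\<close> injects into \<open>\<pi>\<^sub>i Y\<close>; this also gives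
  truncatedness. In degrees \<open>0 < i \<le> n\<close> the fibers of \<open>p\<close> have trivial \<open>\<pi>\<^bsub>i-1\<^esub>\<close>, so every class in
  \<open>\<pi>\<^sub>i Z\<close> comes from \<open>\<pi>\<^sub>i X\<close> up to transport along a path from \<open>p x\<close> to the base point. On \<open>\<pi>\<^sub>0\<close>, \<open>q\<close> is
  injective if \<open>n = -2\<close>, and \<open>p\<close> is surjective otherwise. Both exactness statements are proved
  without group structures, by reading off explicit homotopies along families of straight
  segments in a square.
\<close>

abbreviation unit_interval :: "real topology" where
  "unit_interval \<equiv> top_of_set {0..1}"

section \<open>Maps into the unit interval\<close>

lemma continuous_map_into_unit_interval:
  "continuous_map T unit_interval a \<longleftrightarrow>
     continuous_map T euclideanreal a \<and> (\<forall>x\<in>topspace T. 0 \<le> a x \<and> a x \<le> 1)"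
  by (auto simp: continuous_map_in_subtopology)

lemma continuous_map_comp:
  assumes "continuous_map X Y g" "continuous_map T X a"
  shows "continuous_map T Y (\<lambda>x. g (a x))"
  using continuous_map_compose[OF assms(2,1)] by (simp add: o_def)

lemma continuous_map_comp_pair:
  assumes "continuous_map (prod_topology A B) Y h" "continuous_map T A a" "continuous_map T B b"
  shows "continuous_map T Y (\<lambda>x. h (a x, b x))"
  by (rule continuous_map_comp[OF assms(1)]) (simp add: continuous_map_paired assms)

lemma unit_interval_continuous_map:
  "continuous_map T unit_interval a \<Longrightarrow> continuous_map T euclideanreal a"
  by (simp add: continuous_map_into_unit_interval)

lemma unit_interval_bounds:
  "continuous_map T unit_interval a \<Longrightarrow> x \<in> topspace T \<Longrightarrow> 0 \<le> a x \<and> a x \<le> 1"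
  by (simp add: continuous_map_into_unit_interval)

text \<open>Every later homotopy is read off along straight segments in a square; this gives the
  continuity of one coordinate of such a segment with moving endpoints.\<close>

lemma continuous_map_unit_interval_convex:
  assumes "continuous_map T unit_interval s" "continuous_map T unit_interval a"
    "continuous_map T unit_interval b"
  shows "continuous_map T unit_interval (\<lambda>x. (1 - s x) * a x + s x * b x)"
  unfolding continuous_map_into_unit_interval
proof (intro conjI ballI)
  show "continuous_map T euclideanreal (\<lambda>x. (1 - s x) * a x + s x * b x)"
    by (intro continuous_intros assms[THEN unit_interval_continuous_map]) simp_all
  fix x assume "x \<in> topspace T"
  note b = assms[THEN unit_interval_bounds, OF this]
  show "0 \<le> (1 - s x) * a x + s x * b x"
    using b by simp
  show "(1 - s x) * a x + s x * b x \<le> 1"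
    using b by (intro convex_bound_le) auto
qed

subsection \<open>Cubes\<close>

lemma topspace_cube: "topspace (cube n) = {..<n} \<rightarrow>\<^sub>E {0..1}"
  by (simp add: cube_def)

lemma continuous_map_into_cube:
  "continuous_map T (cube n) b \<longleftrightarrow>
     b ` topspace T \<subseteq> extensional {..<n} \<and> (\<forall>i<n. continuous_map T unit_interval (\<lambda>x. b x i))"
  by (auto simp: cube_def continuous_map_componentwise)

lemma continuous_map_cube_coordinate:
  assumes "continuous_map T (cube n) b" "i < n"
  shows "continuous_map T euclideanreal (\<lambda>x. b x i)"
  using assms by (auto simp: continuous_map_into_cube continuous_map_into_unit_interval)

lemma continuous_map_cube_proj:
  "i < n \<Longrightarrow> continuous_map (cube n) unit_interval (\<lambda>t. t i)"
  using continuous_map_id[of "cube n"] unfolding continuous_map_into_cube by simp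

lemma continuous_map_cube_snoc:
  assumes "continuous_map T (cube j) b" "continuous_map T unit_interval a"
  shows "continuous_map T (cube (Suc j)) (\<lambda>x. (b x)(j := a x))"
  unfolding continuous_map_into_cube
proof (intro conjI allI impI)
  show "(\<lambda>x. (b x)(j := a x)) ` topspace T \<subseteq> extensional {..<Suc j}"
    using assms(1) by (auto simp: continuous_map_into_cube extensional_def image_subset_iff)
  show "continuous_map T unit_interval (\<lambda>x. ((b x)(j := a x)) i)" if "i < Suc j" for i
    using that assms by (cases "i = j") (auto simp: continuous_map_into_cube)
qed

lemma continuous_map_cube_init:
  assumes "continuous_map T (cube (Suc j)) b"
  shows "continuous_map T (cube j) (\<lambda>x. restrict (b x) {..<j})"
  unfolding continuous_map_into_cube
proof (intro conjI allI impI)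
  show "continuous_map T unit_interval (\<lambda>x. restrict (b x) {..<j} i)" if "i < j" for i
    using that assms by (simp add: continuous_map_into_cube less_SucI)
qed auto

lemma in_cube_iff:
  "t \<in> topspace (cube n) \<longleftrightarrow> (\<forall>i<n. t i \<in> {0..1}) \<and> (\<forall>i\<ge>n. t i = undefined)"
  unfolding topspace_cube PiE_iff extensional_def by (auto simp: not_less)

lemma cube_snoc_in:
  assumes "t \<in> topspace (cube j)" "r \<in> {0..1}"
  shows "t(j := r) \<in> topspace (cube (Suc j))"
  using assms unfolding in_cube_iff by (metis Suc_le_eq fun_upd_apply less_Suc_eq nat_less_le)

lemma cube_init_in:
  assumes "t \<in> topspace (cube (Suc j))"
  shows "restrict t {..<j} \<in> topspace (cube j)"
  using assms unfolding in_cube_iff by (simp add: less_SucI)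

lemma cube_snoc_init:
  assumes "t \<in> topspace (cube (Suc j))"
  shows "(restrict t {..<j})(j := t j) = t"
proof
  show "((restrict t {..<j})(j := t j)) i = t i" for i
    using assms unfolding in_cube_iff by (cases "i < j"; cases "i = j") simp_all
qed

lemma cube_last_in:
  assumes "t \<in> topspace (cube (Suc j))"
  shows "t j \<in> {0..1}"
  using assms by (simp add: in_cube_iff)

lemma in_cube_boundary_iff:
  "t \<in> cube_boundary n \<longleftrightarrow> t \<in> topspace (cube n) \<and> (\<exists>i<n. t i = 0 \<or> t i = 1)"
  by (simp add: cube_boundary_def)

lemma cube_boundary_snoc:
  assumes "t \<in> topspace (cube j)" "r \<in> {0..1}"
  shows "t(j := r) \<in> cube_boundary (Suc j) \<longleftrightarrow> r = 0 \<or> r = 1 \<or> t \<in> cube_boundary j"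
proof -
  have "(\<exists>i<Suc j. (t(j := r)) i = 0 \<or> (t(j := r)) i = 1) \<longleftrightarrow>
      r = 0 \<or> r = 1 \<or> (\<exists>i<j. t i = 0 \<or> t i = 1)"
    unfolding Ex_less_Suc by auto
  then show ?thesis
    using assms(1) cube_snoc_in[OF assms] unfolding in_cube_boundary_iff by blast
qed

lemma cube_boundary_cases:
  assumes "t \<in> cube_boundary (Suc j)"
  shows "t j = 0 \<or> t j = 1 \<or> restrict t {..<j} \<in> cube_boundary j"
proof -
  have t: "t \<in> topspace (cube (Suc j))"
    using assms unfolding in_cube_boundary_iff by blast
  show ?thesis
    using assms cube_boundary_snoc[OF cube_init_in[OF t] cube_last_in[OF t]]
    unfolding cube_snoc_init[OF t] by blast
qed

lemma continuous_map_cube_update: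
  assumes "continuous_map T (cube n) b" "continuous_map T unit_interval a" "j < n"
  shows "continuous_map T (cube n) (\<lambda>x. (b x)(j := a x))"
  unfolding continuous_map_into_cube
proof (intro conjI allI impI)
  show "(\<lambda>x. (b x)(j := a x)) ` topspace T \<subseteq> extensional {..<n}"
    using assms(1,3) by (auto simp: continuous_map_into_cube extensional_def image_subset_iff)
  show "continuous_map T unit_interval (\<lambda>x. ((b x)(j := a x)) i)" if "i < n" for i
    using that assms by (cases "i = j") (auto simp: continuous_map_into_cube)
qed

lemma cube_boundary_update:
  assumes "t \<in> topspace (cube n)" "j < n" "r = 0 \<or> r = 1"
  shows "t(j := r) \<in> cube_boundary n"
  using assms unfolding in_cube_boundary_iff in_cube_iff by auto

text \<open>A face given by a coordinate other than \<open>j\<close> survives every change of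
  coordinate \<open>j\<close>.\<close>

lemma cube_boundary_update_cases:
  assumes "t \<in> cube_boundary n" "j < n"
  shows "t j = 0 \<or> t j = 1 \<or> (\<forall>r\<in>{0..1}. t(j := r) \<in> cube_boundary n)"
  using assms unfolding in_cube_boundary_iff in_cube_iff by (metis fun_upd_apply leD)

lemma cube_boundary_subset: "cube_boundary n \<subseteq> topspace (cube n)"
  by (auto simp: cube_boundary_def)

subsection \<open>Based maps and homotopies\<close>

lemma homotopy_rel_boundaryI:
  assumes "continuous_map (prod_topology unit_interval (cube n)) X h"
    and "\<And>t. t \<in> topspace (cube n) \<Longrightarrow> h (0, t) = f t"
    and "\<And>t. t \<in> topspace (cube n) \<Longrightarrow> h (1, t) = g t"
    and "\<And>u t. \<lbrakk>u \<in> {0..1}; t \<in> cube_boundary n\<rbrakk> \<Longrightarrow> h (u, t) = x"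
  shows "(f, g) \<in> homotopy_rel_boundary n X x"
proof -
  \<comment> \<open>The boundary condition sees only points of the cube, so the ends of the homotopy
    need to match only there.\<close>
  have "homotopic_with (\<lambda>u. \<forall>t\<in>cube_boundary n. u t = x) (cube n) X f g"
  proof (subst homotopic_with)
    show "(\<forall>t\<in>cube_boundary n. a t = x) \<longleftrightarrow> (\<forall>t\<in>cube_boundary n. b t = x)"
      if "\<And>t. t \<in> topspace (cube n) \<Longrightarrow> a t = b t" for a b :: "(nat \<Rightarrow> real) \<Rightarrow> 'a"
      using that cube_boundary_subset by (metis subsetD)
  qed (use assms in metis)
  then show ?thesis
    by (simp add: homotopy_rel_boundary_def)
qed

lemma homotopy_rel_boundaryE:
  assumes "(f, g) \<in> homotopy_rel_boundary n X x"
  obtains h where "continuous_map (prod_topology unit_interval (cube n)) X h"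
    and "\<And>t. h (0, t) = f t" "\<And>t. h (1, t) = g t"
    and "\<And>u t. \<lbrakk>u \<in> {0..1}; t \<in> cube_boundary n\<rbrakk> \<Longrightarrow> h (u, t) = x"
  using assms unfolding homotopy_rel_boundary_def homotopic_with_def by auto

lemma maps_rel_boundary_const:
  "x \<in> topspace X \<Longrightarrow> (\<lambda>_. x) \<in> maps_rel_boundary n X x"
  by (simp add: maps_rel_boundary_def)

lemma maps_rel_boundary_compose:
  assumes "g \<in> maps_rel_boundary n X x" "continuous_map X Y q"
  shows "q \<circ> g \<in> maps_rel_boundary n Y (q x)"
  using assms by (auto simp: maps_rel_boundary_def intro: continuous_map_compose)

lemma homotopy_group_eq_iff:
  assumes "g \<in> maps_rel_boundary n X x" "h \<in> maps_rel_boundary n X x"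
  shows "homotopy_rel_boundary n X x `` {g} = homotopy_rel_boundary n X x `` {h} \<longleftrightarrow>
    (g, h) \<in> homotopy_rel_boundary n X x"
  using eq_equiv_class_iff[OF equiv_homotopy_rel_boundary assms] .

text \<open>Covers degree 0 along with positive degrees: \<open>cube 0\<close> is one point with
  empty boundary, so there a map is a point and a null homotopy is a path to
  \<open>x\<close>.\<close>

lemma null_homotopic_rel_boundary:
  assumes "n = 0 \<Longrightarrow> path_connected_space X"
    and "n > 0 \<Longrightarrow> is_singleton (homotopy_group n X x)"
    and x: "x \<in> topspace X" and g: "g \<in> maps_rel_boundary n X x"
  shows "(g, \<lambda>_. x) \<in> homotopy_rel_boundary n X x"
proof (cases "n = 0")
  case True
  let ?o = "(\<lambda>_. undefined) :: nat \<Rightarrow> real"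
  have top: "topspace (cube n) = {?o}"
    using True by (simp add: topspace_cube)
  then have "g ?o \<in> topspace X"
    using g by (auto simp: maps_rel_boundary_def continuous_map_def)
  then obtain \<gamma> where \<gamma>: "pathin X \<gamma>" "\<gamma> 0 = g ?o" "\<gamma> 1 = x"
    using assms(1) True x unfolding path_connected_space_def by blast
  show ?thesis
  proof (rule homotopy_rel_boundaryI[where h = "\<lambda>(u, t). \<gamma> u"])
    show "continuous_map (prod_topology unit_interval (cube n)) X (\<lambda>(u, t). \<gamma> u)"
      using continuous_map_comp[OF \<gamma>(1)[unfolded pathin_def] continuous_map_fst]
      by (simp add: case_prod_unfold)
  qed (use True top \<gamma> in \<open>auto simp: cube_boundary_def\<close>)
next
  case False
  then obtain c where c: "homotopy_group n X x = {c}"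
    using assms(2) by (auto simp: is_singleton_def)
  have "homotopy_rel_boundary n X x `` {k} = c" if "k \<in> maps_rel_boundary n X x" for k
    using quotientI[OF that, of "homotopy_rel_boundary n X x"] c
    unfolding homotopy_group_def by auto
  then show ?thesis
    using homotopy_group_eq_iff[OF g maps_rel_boundary_const[OF x]]
      g maps_rel_boundary_const[OF x] by metis
qed

section \<open>Homotopy groups that are finite or singletons\<close>

lemma finite_image_factor:
  assumes "finite (h ` A)" "\<And>a b. \<lbrakk>a \<in> A; b \<in> A; h a = h b\<rbrakk> \<Longrightarrow> k a = k b"
  shows "finite (k ` A)"
proof (rule finite_surj[OF assms(1)])
  show "k ` A \<subseteq> (\<lambda>c. k (inv_into A h c)) ` (h ` A)"
    by (smt (verit) assms(2) f_inv_into_f image_eqI image_subsetI inv_into_into)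
qed

text \<open>As \<open>\<phi>\<close> only has to reflect homotopy, arbitrarily chosen lifts are
  admissible: the class of \<open>\<phi> g\<close> determines that of \<open>g\<close>.\<close>

lemma finite_homotopy_group_transfer:
  assumes "finite (homotopy_group m X x)"
    and "\<And>g. g \<in> maps_rel_boundary n Z z \<Longrightarrow> \<phi> g \<in> maps_rel_boundary m X x"
    and "\<And>g h. \<lbrakk>g \<in> maps_rel_boundary n Z z; h \<in> maps_rel_boundary n Z z;
      (\<phi> g, \<phi> h) \<in> homotopy_rel_boundary m X x\<rbrakk> \<Longrightarrow> (g, h) \<in> homotopy_rel_boundary n Z z"
  shows "finite (homotopy_group n Z z)"
proof -
  let ?A = "maps_rel_boundary n Z z"
  let ?k = "\<lambda>g. homotopy_rel_boundary n Z z `` {g}"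
  let ?h = "\<lambda>g. homotopy_rel_boundary m X x `` {\<phi> g}"
  have "?h ` ?A \<subseteq> homotopy_group m X x"
    unfolding homotopy_group_def using assms(2) by (auto intro: quotientI)
  then have "finite (?h ` ?A)"
    using assms(1) finite_subset by blast
  then have "finite (?k ` ?A)"
  proof (rule finite_image_factor)
    show "?k g = ?k h" if "g \<in> ?A" "h \<in> ?A" "?h g = ?h h" for g h
      using that assms(2,3) homotopy_group_eq_iff by metis
  qed
  moreover have "homotopy_group n Z z = ?k ` ?A"
    by (auto simp: homotopy_group_def quotient_def)
  ultimately show ?thesis by simp
qed

lemma is_singleton_homotopy_group:
  assumes "z \<in> topspace Z"
    and "\<And>g h. \<lbrakk>g \<in> maps_rel_boundary n Z z; h \<in> maps_rel_boundary n Z z\<rbrakk>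
      \<Longrightarrow> (g, h) \<in> homotopy_rel_boundary n Z z"
  shows "is_singleton (homotopy_group n Z z)"
proof (rule is_singletonI')
  show "homotopy_group n Z z \<noteq> {}"
    using maps_rel_boundary_const[OF assms(1)] by (auto simp: homotopy_group_def quotient_def)
  show "c = d" if "c \<in> homotopy_group n Z z" "d \<in> homotopy_group n Z z" for c d
  proof -
    obtain g h where "g \<in> maps_rel_boundary n Z z" "h \<in> maps_rel_boundary n Z z"
      and "c = homotopy_rel_boundary n Z z `` {g}" "d = homotopy_rel_boundary n Z z `` {h}"
      using \<open>c \<in> _\<close> \<open>d \<in> _\<close> unfolding homotopy_group_def by (elim quotientE)
    then show ?thesis
      using assms(2) homotopy_group_eq_iff by metis
  qed
qed

subsection \<open>Mapping spaces and homotopy fibers\<close>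

text \<open>It suffices to test subbasic sets. The points of \<open>A\<close> for which some element
  of the compact \<open>K\<close> is sent outside \<open>U\<close> form the image of a closed set
  under projection along \<open>K\<close>, and this projection is a closed map.\<close>

lemma continuous_map_curry:
  assumes h: "continuous_map (prod_topology A B) Y h"
  shows "continuous_map A (mapping_space B Y) (\<lambda>a. \<lambda>b\<in>topspace B. h (a, b))"
proof -
  let ?c = "\<lambda>a. \<lambda>b\<in>topspace B. h (a, b)"
  have cont: "continuous_map B Y (?c a)" if "a \<in> topspace A" for a
  proof (rule continuous_map_eq)
    show "continuous_map B Y (\<lambda>b. h (a, b))"
      by (rule continuous_map_comp_pair[OF h]) (use that in auto)
  qed auto
  show ?thesis
    unfolding mapping_space_def continuous_on_generated_topo_iff
  proof (intro conjI allI impI)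
    show "?c ` topspace A \<subseteq> \<Union> {{g \<in> extensional (topspace B). continuous_map B Y g \<and> g ` K \<subseteq> U} | K U.
        compactin B K \<and> openin Y U}"
    proof
      fix g assume "g \<in> ?c ` topspace A"
      then have "g \<in> topspace (mapping_space B Y)"
        using cont by (auto simp: topspace_mapping_space)
      then show "g \<in> \<Union> {{g \<in> extensional (topspace B). continuous_map B Y g \<and> g ` K \<subseteq> U} | K U.
        compactin B K \<and> openin Y U}"
        unfolding mapping_space_def topology_generated_by_topspace .
    qed
    fix W assume "W \<in> {{g \<in> extensional (topspace B). continuous_map B Y g \<and> g ` K \<subseteq> U} | K U.
        compactin B K \<and> openin Y U}"
    then obtain K U where KU: "compactin B K" "openin Y U"
      and W: "W = {g \<in> extensional (topspace B). continuous_map B Y g \<and> g ` K \<subseteq> U}"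
      by blast
    have K: "K \<subseteq> topspace B"
      using KU(1) compactin_subset_topspace by blast
    have hK: "continuous_map (prod_topology A (subtopology B K)) Y h"
      using continuous_map_comp_pair[OF h continuous_map_fst
          continuous_map_into_fulltopology[OF continuous_map_snd]]
      by simp
    define N where "N = {p \<in> topspace (prod_topology A (subtopology B K)). h p \<in> topspace Y - U}"
    have "closedin (prod_topology A (subtopology B K)) N"
      unfolding N_def by (rule closedin_continuous_map_preimage[OF hK]) (use KU in blast)
    moreover have "closed_map (prod_topology A (subtopology B K)) A fst"
      by (rule Abstract_Topological_Spaces.closed_map_fst) (use KU compact_space_subtopology in blast)
    ultimately have "closedin A (fst ` N)"
      by (simp add: closed_map_def)
    moreover have "?c -` W \<inter> topspace A = topspace A - fst ` N"
    proof -
      have "a \<in> ?c -` W \<longleftrightarrow> a \<notin> fst ` N" if a: "a \<in> topspace A" for a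
      proof -
        have "?c a ` K \<subseteq> U \<longleftrightarrow> (\<forall>b\<in>K. h (a, b) \<in> U)"
          using K by auto
        moreover have "\<forall>b\<in>K. h (a, b) \<in> topspace Y"
          using K a continuous_map_image_subset_topspace[OF h] by auto
        ultimately show ?thesis
          using a K cont[OF a] unfolding W N_def by (auto simp: image_iff)
      qed
      then show ?thesis by blast
    qed
    ultimately show "openin A (?c -` W \<inter> topspace A)"
      by (simp add: openin_diff)
  qed
qed

text \<open>Evaluation is continuous because the interval is locally compact: a small closed
  interval around \<open>s\<close> that \<open>\<phi> a\<close> maps into \<open>U\<close> yields a
  subbasic neighbourhood of \<open>\<phi> a\<close>.\<close>

lemma continuous_map_uncurry:
  assumes \<phi>: "continuous_map A (mapping_space unit_interval Y) \<phi>"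
  shows "continuous_map (prod_topology A unit_interval) Y (\<lambda>p. \<phi> (fst p) (snd p))"
proof -
  have cont: "continuous_map unit_interval Y (\<phi> a)" if "a \<in> topspace A" for a
    using continuous_map_image_subset_topspace[OF \<phi>] that by (auto simp: topspace_mapping_space)
  show ?thesis
    unfolding continuous_map_def
  proof (intro conjI allI impI)
    show "(\<lambda>p. \<phi> (fst p) (snd p)) \<in> topspace (prod_topology A unit_interval) \<rightarrow> topspace Y"
      using cont by (fastforce simp: continuous_map_def)
    fix U assume U: "openin Y U"
    let ?P = "{p \<in> topspace (prod_topology A unit_interval). \<phi> (fst p) (snd p) \<in> U}"
    show "openin (prod_topology A unit_interval) ?P"
    proof (subst openin_subopen, intro ballI)
      fix p assume "p \<in> ?P"
      then obtain a s where p: "p = (a, s)" and a: "a \<in> topspace A" and s: "s \<in> {0..1}"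
        and in_U: "\<phi> a s \<in> U"
        by (cases p) auto
      have "openin unit_interval {s \<in> topspace unit_interval. \<phi> a s \<in> U}"
        by (rule openin_continuous_map_preimage[OF cont[OF a] U])
      then obtain e where e: "e > 0" "cball s e \<inter> {0..1} \<subseteq> {s \<in> topspace unit_interval. \<phi> a s \<in> U}"
        using s in_U unfolding openin_contains_cball by auto
      define K where "K = cball s e \<inter> {0..1}"
      define W where "W = {g \<in> extensional (topspace unit_interval).
        continuous_map unit_interval Y g \<and> g ` K \<subseteq> U}"
      have "compactin unit_interval K"
        by (auto simp: K_def compactin_subtopology compact_Int)
      then have "openin (mapping_space unit_interval Y) W"
        unfolding mapping_space_def W_def using U by (intro topology_generated_by_Basis) blast
      then have V: "openin A {a \<in> topspace A. \<phi> a \<in> W}"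
        by (rule openin_continuous_map_preimage[OF \<phi>])
      have "openin unit_interval (ball s e \<inter> {0..1})"
        by (metis Int_commute open_ball openin_open_Int)
      with V have "openin (prod_topology A unit_interval) ({a \<in> topspace A. \<phi> a \<in> W} \<times> (ball s e \<inter> {0..1}))"
        by (simp add: openin_prod_Times_iff)
      moreover have "\<phi> a \<in> W"
        using continuous_map_image_subset_topspace[OF \<phi>] a e(2)
        by (auto simp: W_def K_def topspace_mapping_space)
      moreover have "{a \<in> topspace A. \<phi> a \<in> W} \<times> (ball s e \<inter> {0..1}) \<subseteq> ?P"
        using ball_subset_cball[of s e] by (auto simp: W_def K_def)
      ultimately show "\<exists>T. openin (prod_topology A unit_interval) T \<and> p \<in> T \<and> T \<subseteq> ?P"
        using a s e(1) p by (intro exI[of _ "{a \<in> topspace A. \<phi> a \<in> W} \<times> (ball s e \<inter> {0..1})"]) auto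
    qed
  qed
qed

text \<open>A map into the fiber amounts to a map \<open>a\<close> with a homotopy from
  \<open>f \<circ> a\<close> to the constant map at \<open>y\<close>. Paths are restricted to
  \<open>{0..1}\<close> because points of \<open>mapping_space\<close> are extensional.\<close>

lemma continuous_map_into_homotopy_fiber:
  assumes "continuous_map T X a" "continuous_map (prod_topology T unit_interval) Y h"
    and "\<And>x. x \<in> topspace T \<Longrightarrow> h (x, 0) = f (a x)"
    and "\<And>x. x \<in> topspace T \<Longrightarrow> h (x, 1) = y"
  shows "continuous_map T (homotopy_fiber X Y f y) (\<lambda>x. (a x, \<lambda>s\<in>{0..1}. h (x, s)))"
  unfolding homotopy_fiber_def continuous_map_in_subtopology
  using assms(1,3,4) continuous_map_curry[OF assms(2)] by (auto simp: continuous_map_paired)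

lemma continuous_map_fiber_path:
  assumes "continuous_map T (homotopy_fiber X Y f y) \<phi>"
  shows "continuous_map (prod_topology T unit_interval) Y (\<lambda>p. snd (\<phi> (fst p)) (snd p))"
proof -
  have "continuous_map T (mapping_space unit_interval Y) (\<lambda>x. snd (\<phi> x))"
    using assms unfolding homotopy_fiber_def continuous_map_in_subtopology
    by (auto intro: continuous_map_comp[OF continuous_map_snd])
  then show ?thesis by (rule continuous_map_uncurry)
qed

lemma continuous_map_fiber_point:
  assumes "continuous_map T (homotopy_fiber X Y f y) \<phi>"
  shows "continuous_map T X (\<lambda>x. fst (\<phi> x))"
  using assms unfolding homotopy_fiber_def continuous_map_in_subtopology
  by (auto intro: continuous_map_comp[OF continuous_map_fst])

lemma fiber_path_endpoints:
  assumes "e \<in> topspace (homotopy_fiber X Y f y)"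
  shows "fst e \<in> topspace X" "continuous_map unit_interval Y (snd e)"
    "snd e 0 = f (fst e)" "snd e 1 = y"
  using assms by (auto simp: homotopy_fiber_def topspace_mapping_space)

lemma homotopy_fiberI:
  assumes "x \<in> topspace X" "continuous_map unit_interval Y \<gamma>" "\<gamma> 0 = f x" "\<gamma> 1 = y"
  shows "(x, restrict \<gamma> {0..1}) \<in> topspace (homotopy_fiber X Y f y)"
  using assms by (auto simp: homotopy_fiber_def topspace_mapping_space intro: continuous_map_eq)

subsection \<open>Exactness at the total space\<close>

text \<open>Injectivity of \<open>q\<close> in degree \<open>n\<close>: a homotopy from
  \<open>q \<circ> g\<close> to \<open>q \<circ> h\<close> lifts \<open>g\<close> followed by the
  reverse of \<open>h\<close> to the fiber, and a contraction of that lift is rearranged into a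
  homotopy from \<open>g\<close> to \<open>h\<close>.\<close>

lemma homotopy_rel_boundary_of_trivial_fiber:
  assumes q: "continuous_map Z Y q" and z: "z \<in> topspace Z" and n: "n > 0"
    and sing: "is_singleton (homotopy_group n (homotopy_fiber Z Y q (q z)) (z, \<lambda>s\<in>{0..1}. q z))"
    and g: "g \<in> maps_rel_boundary n Z z" and h: "h \<in> maps_rel_boundary n Z z"
    and qgh: "(q \<circ> g, q \<circ> h) \<in> homotopy_rel_boundary n Y (q z)"
  shows "(g, h) \<in> homotopy_rel_boundary n Z z"
proof -
  obtain H where H: "continuous_map (prod_topology unit_interval (cube n)) Y H"
    and H0: "\<And>t. H (0, t) = q (g t)" and H1: "\<And>t. H (1, t) = q (h t)"
    and H_bd: "\<And>u t. \<lbrakk>u \<in> {0..1}; t \<in> cube_boundary n\<rbrakk> \<Longrightarrow> H (u, t) = q z"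
    using homotopy_rel_boundaryE[OF qgh] unfolding o_apply by blast
  have g_cont: "continuous_map (cube n) Z g" and g_bd: "\<And>t. t \<in> cube_boundary n \<Longrightarrow> g t = z"
    and h_cont: "continuous_map (cube n) Z h" and h_bd: "\<And>t. t \<in> cube_boundary n \<Longrightarrow> h t = z"
    using g h by (auto simp: maps_rel_boundary_def)
  \<comment> \<open>\<open>r \<mapsto> (\<alpha> r, \<beta> r)\<close> runs through the sides \<open>{0} \<times> [0, 1]\<close>, \<open>[0, 1] \<times> {1}\<close>, \<open>{1} \<times> [1, 0]\<close> of the
    square, so that \<open>G\<close> below is \<open>g\<close> followed by the reverse of \<open>h\<close>.\<close>
  define \<alpha> \<beta> :: "real \<Rightarrow> real"
    where "\<alpha> r = max 0 (min 1 (3 * r - 1))" and "\<beta> r = max 0 (min 1 (min (3 * r) (3 - 3 * r)))" for r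
  have \<alpha>: "continuous_map T unit_interval (\<lambda>x. \<alpha> (a x))"
    and \<beta>: "continuous_map T unit_interval (\<lambda>x. \<beta> (a x))"
    if "continuous_map T unit_interval a" for T and a :: "'x \<Rightarrow> real"
    using unit_interval_continuous_map[OF that]
    unfolding continuous_map_into_unit_interval \<alpha>_def \<beta>_def
    by (auto intro!: continuous_intros)
  define G where "G t = (if t 0 \<le> 1/2 then g (t(0 := \<beta> (t 0))) else h (t(0 := \<beta> (t 0))))" for t
  have coord: "continuous_map (cube n) unit_interval (\<lambda>t. t 0)"
    using n by (rule continuous_map_cube_proj)
  note upd = continuous_map_cube_update[OF _ _ n]
  have G_cont: "continuous_map (cube n) Z G"
    unfolding G_def
  proof (rule continuous_map_cases_le)
    show "continuous_map (cube n) euclideanreal (\<lambda>t. t 0)"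
      using coord by (rule unit_interval_continuous_map)
    have "continuous_map (cube n) (cube n) (\<lambda>t. t(0 := \<beta> (t 0)))"
      by (intro upd \<beta> coord) simp
    then show "continuous_map (subtopology (cube n) {t \<in> topspace (cube n). t 0 \<le> 1/2}) Z
          (\<lambda>t. g (t(0 := \<beta> (t 0))))"
      and "continuous_map (subtopology (cube n) {t \<in> topspace (cube n). 1/2 \<le> t 0}) Z
          (\<lambda>t. h (t(0 := \<beta> (t 0))))"
      by (auto intro!: continuous_map_from_subtopology continuous_map_comp[OF g_cont]
          continuous_map_comp[OF h_cont])
    \<comment> \<open>At 1/2 the value of \<open>\<beta>\<close> is 1, so both branches are
      evaluated on a face of the cube and equal \<open>z\<close>.\<close>
    show "g (t(0 := \<beta> (t 0))) = h (t(0 := \<beta> (t 0)))" if "t \<in> topspace (cube n)" "t 0 = 1/2" for t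
      using cube_boundary_update[OF that(1) n, of "\<beta> (t 0)"] that(2) g_bd h_bd
      by (simp add: \<beta>_def)
  qed simp
  have bounds: "t 0 \<in> {0..1}" "\<alpha> (t 0) \<in> {0..1}" "\<beta> (t 0) \<in> {0..1}" if "t \<in> topspace (cube n)" for t
    using that n by (auto simp: in_cube_iff \<alpha>_def \<beta>_def)
  \<comment> \<open>Pushing the three sides linearly onto \<open>[0, 1] \<times> {0}\<close>, where \<open>H\<close> is constant, contracts \<open>q \<circ> G\<close>.\<close>
  define J where "J p = H ((1 - snd p) * \<alpha> (fst p 0) + snd p * fst p 0,
      (fst p)(0 := (1 - snd p) * \<beta> (fst p 0) + snd p * 0))" for p
  have "continuous_map (prod_topology (cube n) unit_interval) unit_interval (\<lambda>p. fst p 0)"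
    by (rule continuous_map_comp[OF coord continuous_map_fst])
  then have J_cont: "continuous_map (prod_topology (cube n) unit_interval) Y J"
    unfolding J_def
    by (intro continuous_map_comp_pair[OF H] continuous_map_unit_interval_convex upd \<alpha> \<beta>
        continuous_map_fst continuous_map_snd) simp_all
  define \<phi> where "\<phi> t = (G t, \<lambda>s\<in>{0..1}. J (t, s))" for t
  define e where "e = (z, \<lambda>s\<in>{0..1::real}. q z)"
  let ?F = "homotopy_fiber Z Y q (q z)"
  have J0: "J (t, 0) = q (G t)" if t: "t \<in> topspace (cube n)" for t
  proof -
    have J_eq: "J (t, 0) = H (\<alpha> (t 0), t(0 := \<beta> (t 0)))"
      by (simp add: J_def)
    \<comment> \<open>The thirds are the three sides: \<open>H\<close> is \<open>q \<circ> g\<close>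
      on the first, constant on the second and \<open>q \<circ> h\<close> on the third.\<close>
    consider "t 0 \<le> 1/3" | "1/3 \<le> t 0 \<and> t 0 \<le> 2/3" | "2/3 \<le> t 0" by linarith
    then show ?thesis
    proof cases
      case 1
      then have "\<alpha> (t 0) = 0" by (simp add: \<alpha>_def)
      then show ?thesis using 1 J_eq H0 by (simp add: G_def)
    next
      case 2
      then have "\<beta> (t 0) = 1" by (auto simp: \<beta>_def)
      then have "t(0 := \<beta> (t 0)) \<in> cube_boundary n"
        using cube_boundary_update[OF t n] by simp
      then show ?thesis
        using J_eq H_bd bounds(2)[OF t] g_bd h_bd by (simp add: G_def)
    next
      case 3
      then have "\<alpha> (t 0) = 1" by (simp add: \<alpha>_def)
      then show ?thesis using 3 J_eq H1 by (simp add: G_def)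
    qed
  qed
  have \<phi>: "\<phi> \<in> maps_rel_boundary n ?F e"
    unfolding maps_rel_boundary_def
  proof (intro CollectI conjI ballI)
    show "continuous_map (cube n) ?F \<phi>"
      unfolding \<phi>_def
    proof (rule continuous_map_into_homotopy_fiber[OF G_cont J_cont J0])
      show "J (t, 1) = q z" if t: "t \<in> topspace (cube n)" for t
        using H_bd[OF bounds(1)[OF t] cube_boundary_update[OF t n, of 0]] by (simp add: J_def)
    qed
    fix t assume t: "t \<in> cube_boundary n"
    then have t': "t \<in> topspace (cube n)" using cube_boundary_subset by blast
    \<comment> \<open>On a face of coordinate 0 the function \<open>\<beta>\<close> vanishes, so the
      new coordinate is 0; any other face survives the change.\<close>
    have bd: "t(0 := (1 - s) * \<beta> (t 0)) \<in> cube_boundary n" if s: "s \<in> {0..1}" for s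
    proof -
      have "(1 - s) * \<beta> (t 0) \<in> {0..1}"
        using s bounds(3)[OF t'] by (auto simp: mult_le_one)
      moreover have "\<beta> (t 0) = 0" if "t 0 = 0 \<or> t 0 = 1"
        using that by (auto simp: \<beta>_def)
      ultimately show ?thesis
        using cube_boundary_update_cases[OF t n] cube_boundary_update[OF t' n, of "(1 - s) * \<beta> (t 0)"]
        by auto
    qed
    have "G t = z"
      using bd[of 0] g_bd h_bd by (simp add: G_def)
    moreover have "J (t, s) = q z" if s: "s \<in> {0..1}" for s
    proof -
      have "(1 - s) * \<alpha> (t 0) + s * t 0 \<in> {0..1}"
        using s bounds[OF t'] by (auto intro!: convex_bound_le)
      then show ?thesis using bd[OF s] H_bd by (simp add: J_def)
    qed
    ultimately show "\<phi> t = e" by (auto simp: \<phi>_def e_def)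
  qed
  have e: "e \<in> topspace ?F"
    unfolding e_def by (rule homotopy_fiberI) (use z q in \<open>auto simp: continuous_map_def\<close>)
  have "(\<phi>, \<lambda>_. e) \<in> homotopy_rel_boundary n ?F e"
    by (rule null_homotopic_rel_boundary) (use n sing e \<phi> in \<open>auto simp: e_def\<close>)
  then obtain L where L: "continuous_map (prod_topology unit_interval (cube n)) ?F L"
    and L0: "\<And>t. L (0, t) = \<phi> t" and L1: "\<And>t. L (1, t) = e"
    and L_bd: "\<And>u t. \<lbrakk>u \<in> {0..1}; t \<in> cube_boundary n\<rbrakk> \<Longrightarrow> L (u, t) = e"
    by (elim homotopy_rel_boundaryE) auto
  \<comment> \<open>The segments from \<open>(\<beta> u, \<alpha> u)\<close>, a point where the contraction \<open>L\<close> of \<open>G\<close> takes the value \<open>z\<close>,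
    to \<open>(0, 1/3 + u/3)\<close>, where \<open>G\<close> pauses at \<open>z\<close>, deform \<open>g\<close> into \<open>h\<close>.\<close>
  define M where "M p = fst (L ((1 - snd p 0) * \<beta> (fst p) + snd p 0 * 0,
      (snd p)(0 := (1 - snd p 0) * \<alpha> (fst p) + snd p 0 * (1/3 + fst p / 3))))" for p
  show ?thesis
  proof (rule homotopy_rel_boundaryI[where h = M])
    have "continuous_map (prod_topology unit_interval (cube n)) unit_interval (\<lambda>p. 1/3 + fst p / 3)"
      unfolding continuous_map_into_unit_interval
      by (auto intro!: continuous_intros continuous_map_into_fulltopology[OF continuous_map_fst])
    moreover have "continuous_map (prod_topology unit_interval (cube n)) unit_interval (\<lambda>p. snd p 0)"
      by (rule continuous_map_comp[OF coord continuous_map_snd])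
    ultimately show "continuous_map (prod_topology unit_interval (cube n)) Z M"
      unfolding M_def
      by (intro continuous_map_comp_pair[OF continuous_map_fiber_point[OF L]]
          continuous_map_unit_interval_convex upd \<alpha> \<beta>
          continuous_map_fst continuous_map_snd) simp_all
  next
    fix t assume t: "t \<in> topspace (cube n)"
    note b = bounds(1)[OF t]
    have "M (0, t) = G (t(0 := t 0 / 3))"
      by (simp add: M_def \<alpha>_def \<beta>_def L0 \<phi>_def)
    moreover have "\<beta> (t 0 / 3) = t 0"
      using b by (auto simp: \<beta>_def)
    ultimately show "M (0, t) = g t"
      using b by (simp add: G_def)
    have "M (1, t) = G (t(0 := 1 - t 0 / 3))"
      by (simp add: M_def \<alpha>_def \<beta>_def L0 \<phi>_def algebra_simps)
    moreover have "\<beta> (1 - t 0 / 3) = t 0"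
      using b by (auto simp: \<beta>_def)
    ultimately show "M (1, t) = h t"
      using b by (simp add: G_def)
  next
    fix u :: real and t assume u: "u \<in> {0..1}" and t: "t \<in> cube_boundary n"
    then have t': "t \<in> topspace (cube n)" using cube_boundary_subset by blast
    have \<alpha>u: "\<alpha> u \<in> {0..1}" and \<beta>u: "\<beta> u \<in> {0..1}"
      by (auto simp: \<alpha>_def \<beta>_def)
    consider "t 0 = 0" | "t 0 = 1" | "\<forall>r\<in>{0..1}. t(0 := r) \<in> cube_boundary n"
      using cube_boundary_update_cases[OF t n] by blast
    then show "M (u, t) = z"
    proof cases
      case 1
      then have M_eq: "M (u, t) = fst (L (\<beta> u, t(0 := \<alpha> u)))"
        by (simp add: M_def)
      \<comment> \<open>The starting points lie on the three sides where \<open>L\<close> is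
        constantly \<open>e\<close>: two come from faces of the cube, the third is the end of the
        contraction.\<close>
      have "\<alpha> u = 0 \<or> \<alpha> u = 1 \<or> \<beta> u = 1"
        by (cases "u \<le> 1/3"; cases "u \<le> 2/3") (auto simp: \<alpha>_def \<beta>_def)
      then consider "\<alpha> u = 0 \<or> \<alpha> u = 1" | "\<beta> u = 1" by blast
      then show ?thesis
      proof cases
        case 1
        then show ?thesis
          using M_eq L_bd[OF \<beta>u cube_boundary_update[OF t' n]] by (simp add: e_def)
      next
        case 2
        then show ?thesis using M_eq L1 by (simp add: e_def)
      qed
    next
      case 2
      have "\<beta> (1/3 + u/3) = 1"
        using u by (auto simp: \<beta>_def)
      moreover have "M (u, t) = G (t(0 := 1/3 + u/3))"
        using 2 by (simp add: M_def L0 \<phi>_def)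
      ultimately show ?thesis
        using cube_boundary_update[OF t' n, of 1] g_bd h_bd by (simp add: G_def)
    next
      case 3
      have "(1 - t 0) * \<alpha> u + t 0 * (1/3 + u/3) \<in> {0..1}"
        using bounds(1)[OF t'] \<alpha>u u by (auto intro!: convex_bound_le)
      moreover have "(1 - t 0) * \<beta> u \<in> {0..1}"
        using bounds(1)[OF t'] \<beta>u by (auto simp: mult_le_one)
      ultimately show ?thesis
        using 3 L_bd by (simp add: M_def e_def)
    qed
  qed
qed

subsection \<open>Free homotopies with a prescribed boundary trace\<close>

text \<open>
  The map \<open>f\<close> is \<open>K (0, _)\<close> on a concentric half-size cube, with the trace \<open>\<omega>\<close> spread over the
  surrounding collar. At each point either the time argument of \<open>K\<close> is \<open>0\<close> or its space argument
  lies in the boundary, so \<open>f\<close> depends only on \<open>K (0, _)\<close> and \<open>\<omega>\<close>.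
\<close>

lemma homotopic_collar:
  assumes K: "continuous_map (prod_topology unit_interval (cube n)) Z K"
    and K_bd: "\<And>u t. \<lbrakk>u \<in> {0..1}; t \<in> cube_boundary n\<rbrakk> \<Longrightarrow> K (u, t) = \<omega> u"
    and f: "\<And>t. t \<in> topspace (cube n) \<Longrightarrow>
      f t = K (1 - (\<Prod>i<n. max 0 (min 1 (min (4 * t i) (4 - 4 * t i)))),
               \<lambda>i\<in>{..<n}. max 0 (min 1 (2 * t i - 1/2)))"
    and g: "\<And>t. t \<in> topspace (cube n) \<Longrightarrow> g t = K (1, t)"
  shows "(f, g) \<in> homotopy_rel_boundary n Z (\<omega> 1)"
proof -
  \<comment> \<open>\<open>\<sigma>\<close> is 0 where all coordinates lie in [1/4, 3/4] and 1 on
    the boundary. \<open>E u\<close> dilates about the centre by \<open>2 - u\<close> and clamps, so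
    \<open>E 1\<close> fixes the cube pointwise.\<close>
  define \<sigma> where "\<sigma> t = 1 - (\<Prod>i<n. max 0 (min 1 (min (4 * t i) (4 - 4 * t i))))" for t :: "nat \<Rightarrow> real"
  define E where "E u t = (\<lambda>i\<in>{..<n}. max 0 (min 1 ((2 - u) * (t i - 1/2) + 1/2)))"
    for u :: real and t :: "nat \<Rightarrow> real"
  let ?T = "prod_topology unit_interval (cube n)"
  have \<sigma>_bounds: "\<sigma> t \<in> {0..1}" for t
    by (auto simp: \<sigma>_def intro!: prod_nonneg prod_le_1)
  have coord: "continuous_map ?T euclideanreal (\<lambda>p. snd p i)" if "i < n" for i
    using that by (intro continuous_map_cube_coordinate[of _ n] continuous_map_snd)
  have time: "continuous_map ?T euclideanreal fst"
    using continuous_map_fst by (rule continuous_map_into_fulltopology)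
  have \<sigma>: "continuous_map ?T unit_interval (\<lambda>p. max (fst p) (\<sigma> (snd p)))"
    unfolding continuous_map_into_unit_interval
  proof (intro conjI ballI)
    show "continuous_map ?T euclideanreal (\<lambda>p. max (fst p) (\<sigma> (snd p)))"
      unfolding \<sigma>_def by (intro continuous_intros time) (auto intro: coord)
  qed (use \<sigma>_bounds in \<open>auto simp: le_max_iff_disj\<close>)
  have E: "continuous_map ?T (cube n) (\<lambda>p. E (fst p) (snd p))"
    unfolding continuous_map_into_cube
  proof (intro conjI allI impI)
    fix i assume i: "i < n"
    have "continuous_map ?T unit_interval
        (\<lambda>p. max 0 (min 1 ((2 - fst p) * (snd p i - 1/2) + 1/2)))"
      unfolding continuous_map_into_unit_interval
      by (intro conjI continuous_intros time coord i) auto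
    then show "continuous_map ?T unit_interval (\<lambda>p. E (fst p) (snd p) i)"
      using i by (simp add: E_def)
  qed (auto simp: E_def)
  show ?thesis
  proof (rule homotopy_rel_boundaryI[where h = "\<lambda>p. K (max (fst p) (\<sigma> (snd p)), E (fst p) (snd p))"])
    show "continuous_map ?T Z (\<lambda>p. K (max (fst p) (\<sigma> (snd p)), E (fst p) (snd p)))"
      by (rule continuous_map_comp_pair[OF K \<sigma> E])
  next
    fix t assume t: "t \<in> topspace (cube n)"
    have "E 0 t = (\<lambda>i\<in>{..<n}. max 0 (min 1 (2 * t i - 1/2)))"
      by (simp add: E_def algebra_simps)
    then show "K (max (fst (0, t)) (\<sigma> (snd (0, t))), E (fst (0, t)) (snd (0, t))) = f t"
      using \<sigma>_bounds[of t] f[OF t] by (simp add: \<sigma>_def)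
    have "E 1 t i = t i" for i
      using t unfolding in_cube_iff E_def by (cases "i < n") auto
    then have "E 1 t = t" by blast
    then show "K (max (fst (1, t)) (\<sigma> (snd (1, t))), E (fst (1, t)) (snd (1, t))) = g t"
      using \<sigma>_bounds[of t] g[OF t] by (simp add: max_absorb1)
  next
    fix u :: real and t assume u: "u \<in> {0..1}" and t: "t \<in> cube_boundary n"
    then obtain i where i: "i < n" "t i = 0 \<or> t i = 1"
      unfolding in_cube_boundary_iff by blast
    then have "(\<Prod>i<n. max 0 (min 1 (min (4 * t i) (4 - 4 * t i)))) = 0"
      by (intro prod_zero bexI[of _ i]) auto
    then have "\<sigma> t = 1" by (simp add: \<sigma>_def)
    have "E u t \<in> topspace (cube n)"
      unfolding in_cube_iff E_def by auto
    \<comment> \<open>The dilation factor is at least 1, so a coordinate on a face is clamped to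
      that same face.\<close>
    moreover have "E u t i = 0 \<or> E u t i = 1"
      using i u by (auto simp: E_def min_def max_def field_simps)
    ultimately have "E u t \<in> cube_boundary n"
      using i unfolding in_cube_boundary_iff by blast
    then show "K (max (fst (u, t)) (\<sigma> (snd (u, t))), E (fst (u, t)) (snd (u, t))) = \<omega> 1"
      using K_bd[of 1] u \<open>\<sigma> t = 1\<close> by (simp add: max_absorb2)
  qed
qed

text \<open>\<open>K\<close> and \<open>K'\<close> have the same collar map, and each end is
  homotopic to it.\<close>

lemma homotopic_if_same_start_and_trace:
  assumes K: "continuous_map (prod_topology unit_interval (cube n)) Z K"
    and K_bd: "\<And>u t. \<lbrakk>u \<in> {0..1}; t \<in> cube_boundary n\<rbrakk> \<Longrightarrow> K (u, t) = \<omega> u"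
    and K': "continuous_map (prod_topology unit_interval (cube n)) Z K'"
    and K'_bd: "\<And>u t. \<lbrakk>u \<in> {0..1}; t \<in> cube_boundary n\<rbrakk> \<Longrightarrow> K' (u, t) = \<omega> u"
    and start: "\<And>t. t \<in> topspace (cube n) \<Longrightarrow> K (0, t) = K' (0, t)"
    and g: "\<And>t. t \<in> topspace (cube n) \<Longrightarrow> g t = K (1, t)"
    and g': "\<And>t. t \<in> topspace (cube n) \<Longrightarrow> g' t = K' (1, t)"
  shows "(g, g') \<in> homotopy_rel_boundary n Z (\<omega> 1)"
proof -
  define \<sigma> where "\<sigma> t = 1 - (\<Prod>i<n. max 0 (min 1 (min (4 * t i) (4 - 4 * t i))))" for t :: "nat \<Rightarrow> real"
  define E where "E t = (\<lambda>i\<in>{..<n}. max 0 (min 1 (2 * t i - 1/2)))" for t :: "nat \<Rightarrow> real"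
  have eq: "K (\<sigma> t, E t) = K' (\<sigma> t, E t)" if t: "t \<in> topspace (cube n)" for t
  proof -
    have E_cube: "E t \<in> topspace (cube n)"
      unfolding in_cube_iff E_def by auto
    show ?thesis
    \<comment> \<open>In the collar \<open>E t\<close> is a boundary point, where only the trace
      counts; otherwise \<open>\<sigma> t\<close> is 0 and only the starting map counts.\<close>
    proof (cases "\<exists>i<n. t i \<le> 1/4 \<or> t i \<ge> 3/4")
      case True
      then obtain i where i: "i < n" "t i \<le> 1/4 \<or> t i \<ge> 3/4" by blast
      then have "E t i = 0 \<or> E t i = 1" by (auto simp: E_def)
      then have "E t \<in> cube_boundary n"
        using i E_cube unfolding in_cube_boundary_iff by blast
      moreover have "\<sigma> t \<in> {0..1}"
        by (auto simp: \<sigma>_def intro!: prod_nonneg prod_le_1)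
      ultimately show ?thesis using K_bd K'_bd by simp
    next
      case False
      then have "max 0 (min 1 (min (4 * t i) (4 - 4 * t i))) = 1" if "i < n" for i
        using that by force
      then have "\<sigma> t = 0" by (simp add: \<sigma>_def)
      then show ?thesis using start[OF E_cube] by simp
    qed
  qed
  have "(\<lambda>t. K (\<sigma> t, E t), g) \<in> homotopy_rel_boundary n Z (\<omega> 1)"
    by (rule homotopic_collar[OF K K_bd]) (auto simp: \<sigma>_def E_def g)
  moreover have "(\<lambda>t. K (\<sigma> t, E t), g') \<in> homotopy_rel_boundary n Z (\<omega> 1)"
  proof (rule homotopic_collar[OF K' K'_bd])
    show "K (\<sigma> t, E t) = K' (1 - (\<Prod>i<n. max 0 (min 1 (min (4 * t i) (4 - 4 * t i)))),
        \<lambda>i\<in>{..<n}. max 0 (min 1 (2 * t i - 1/2)))" if "t \<in> topspace (cube n)" for t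
      using eq[OF that] by (simp add: \<sigma>_def E_def)
  qed (auto simp: g')
  ultimately show ?thesis
    using equiv_homotopy_rel_boundary[of n Z "\<omega> 1"] by (meson equivE symE transE)
qed

text \<open>Transport along \<open>\<omega>\<close> is well defined on classes: a homotopy from
  \<open>G\<close> to \<open>G'\<close>, composed with \<open>p\<close>, is spliced in before
  \<open>K'\<close>.\<close>

lemma homotopic_if_free_lifts_homotopic:
  assumes p: "continuous_map X Z p"
    and K: "continuous_map (prod_topology unit_interval (cube n)) Z K"
    and K_bd: "\<And>u t. \<lbrakk>u \<in> {0..1}; t \<in> cube_boundary n\<rbrakk> \<Longrightarrow> K (u, t) = \<omega> u"
    and K0: "\<And>t. t \<in> topspace (cube n) \<Longrightarrow> K (0, t) = p (G t)"
    and K1: "\<And>t. t \<in> topspace (cube n) \<Longrightarrow> K (1, t) = g t"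
    and K': "continuous_map (prod_topology unit_interval (cube n)) Z K'"
    and K'_bd: "\<And>u t. \<lbrakk>u \<in> {0..1}; t \<in> cube_boundary n\<rbrakk> \<Longrightarrow> K' (u, t) = \<omega> u"
    and K'0: "\<And>t. t \<in> topspace (cube n) \<Longrightarrow> K' (0, t) = p (G' t)"
    and K'1: "\<And>t. t \<in> topspace (cube n) \<Longrightarrow> K' (1, t) = g' t"
    and GG': "(G, G') \<in> homotopy_rel_boundary n X x" and \<omega>0: "\<omega> 0 = p x"
  shows "(g, g') \<in> homotopy_rel_boundary n Z (\<omega> 1)"
proof -
  obtain H where H: "continuous_map (prod_topology unit_interval (cube n)) X H"
    and H0: "\<And>t. H (0, t) = G t" and H1: "\<And>t. H (1, t) = G' t"
    and H_bd: "\<And>u t. \<lbrakk>u \<in> {0..1}; t \<in> cube_boundary n\<rbrakk> \<Longrightarrow> H (u, t) = x"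
    using homotopy_rel_boundaryE[OF GG'] by blast
  let ?T = "prod_topology unit_interval (cube n)"
  define \<delta> \<epsilon> :: "real \<Rightarrow> real" where "\<delta> u = min 1 (2 * u)" and "\<epsilon> u = max 0 (2 * u - 1)" for u
  have time: "continuous_map ?T euclideanreal fst"
    using continuous_map_fst by (rule continuous_map_into_fulltopology)
  have \<delta>: "continuous_map ?T unit_interval (\<lambda>p. \<delta> (fst p))"
    and \<epsilon>: "continuous_map ?T unit_interval (\<lambda>p. \<epsilon> (fst p))"
    unfolding continuous_map_into_unit_interval \<delta>_def \<epsilon>_def
    by (auto intro!: continuous_intros time)
  \<comment> \<open>The trace of \<open>K'\<close> is preceded by a pause at \<open>p x\<close> to make room for \<open>p \<circ> H\<close>; pausing in \<open>K\<close> as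
    well makes both homotopies start at \<open>p \<circ> G\<close> with the same trace \<open>\<omega> \<circ> \<epsilon>\<close>.\<close>
  define M where "M = (\<lambda>p. K (\<epsilon> (fst p), snd p))"
  define M' where "M' = (\<lambda>q. if fst q \<le> 1/2 then p (H (\<delta> (fst q), snd q)) else K' (\<epsilon> (fst q), snd q))"
  have "(g, g') \<in> homotopy_rel_boundary n Z ((\<omega> \<circ> \<epsilon>) 1)"
  proof (rule homotopic_if_same_start_and_trace[where K = M and K' = M'])
    show "continuous_map ?T Z M"
      unfolding M_def by (intro continuous_map_comp_pair[OF K] \<epsilon> continuous_map_snd)
    show "continuous_map ?T Z M'"
      unfolding M'_def
    proof (rule continuous_map_cases_le[OF time])
      show "continuous_map (subtopology ?T {q \<in> topspace ?T. fst q \<le> 1/2}) Z (\<lambda>q. p (H (\<delta> (fst q), snd q)))"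
        by (intro continuous_map_from_subtopology continuous_map_comp[OF p]
            continuous_map_comp_pair[OF H] \<delta> continuous_map_snd)
      show "continuous_map (subtopology ?T {q \<in> topspace ?T. 1/2 \<le> fst q}) Z (\<lambda>q. K' (\<epsilon> (fst q), snd q))"
        by (intro continuous_map_from_subtopology continuous_map_comp_pair[OF K'] \<epsilon> continuous_map_snd)
      show "p (H (\<delta> (fst q), snd q)) = K' (\<epsilon> (fst q), snd q)"
        if "q \<in> topspace ?T" "fst q = 1/2" for q
        using that H1 K'0 by (auto simp: \<delta>_def \<epsilon>_def)
    qed simp
    show "M (u, t) = (\<omega> \<circ> \<epsilon>) u" if "u \<in> {0..1}" "t \<in> cube_boundary n" for u t
      using that K_bd[of "\<epsilon> u" t] by (auto simp: M_def \<epsilon>_def)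
    show "M' (u, t) = (\<omega> \<circ> \<epsilon>) u" if "u \<in> {0..1}" "t \<in> cube_boundary n" for u t
      using that K'_bd[of "\<epsilon> u" t] H_bd[of "\<delta> u" t] \<omega>0 by (auto simp: M'_def \<epsilon>_def \<delta>_def)
  qed (use K0 K1 K'1 H0 in \<open>auto simp: M_def M'_def \<epsilon>_def \<delta>_def\<close>)
  then show ?thesis by (simp add: \<epsilon>_def)
qed

subsection \<open>Exactness at the base\<close>

text \<open>Surjectivity in degree \<open>j + 1\<close> up to transport: along its last coordinate
  \<open>g\<close> is a family of loops at \<open>z\<close> over \<open>cube j\<close>. Preceded by
  the path of \<open>e\<close> they form a map into the fiber, and the \<open>X\<close>-components
  of its contraction form \<open>G\<close>.\<close>

lemma free_lift_of_trivial_fiber: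
  assumes p: "continuous_map X Z p"
    and e: "e \<in> topspace (homotopy_fiber X Z p z)"
    and conn: "j = 0 \<Longrightarrow> path_connected_space (homotopy_fiber X Z p z)"
    and sing: "\<And>e. \<lbrakk>j > 0; e \<in> topspace (homotopy_fiber X Z p z)\<rbrakk> \<Longrightarrow>
      is_singleton (homotopy_group j (homotopy_fiber X Z p z) e)"
    and g: "g \<in> maps_rel_boundary (Suc j) Z z"
  obtains G K where "G \<in> maps_rel_boundary (Suc j) X (fst e)"
    and "continuous_map (prod_topology unit_interval (cube (Suc j))) Z K"
    and "\<And>u t. \<lbrakk>u \<in> {0..1}; t \<in> cube_boundary (Suc j)\<rbrakk> \<Longrightarrow> K (u, t) = snd e (min 1 (2 * u))"
    and "\<And>t. t \<in> topspace (cube (Suc j)) \<Longrightarrow> K (0, t) = p (G t)"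
    and "\<And>t. t \<in> topspace (cube (Suc j)) \<Longrightarrow> K (1, t) = g t"
proof -
  let ?F = "homotopy_fiber X Z p z" and ?T = "prod_topology (cube j) unit_interval"
  note e_simps = fiber_path_endpoints[OF e]
  \<comment> \<open>At double speed the path of \<open>e\<close> reaches \<open>z\<close> at 1/2,
    leaving the second half for \<open>g\<close>.\<close>
  define \<omega> where "\<omega> s = snd e (min 1 (2 * s))" for s :: real
  have g_cont: "continuous_map (cube (Suc j)) Z g"
    and g_bd: "\<And>t. t \<in> cube_boundary (Suc j) \<Longrightarrow> g t = z"
    using g by (auto simp: maps_rel_boundary_def)
  have \<omega>_cont: "continuous_map T Z (\<lambda>x. \<omega> (a x))"
    if "continuous_map T unit_interval a" for T and a :: "'x \<Rightarrow> real"
    unfolding \<omega>_def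
    using that by (intro continuous_map_comp[OF e_simps(2)])
      (auto simp: continuous_map_into_unit_interval intro!: continuous_intros)
  have \<omega>_end: "\<omega> s = z" if "s \<ge> 1/2" for s
    using that e_simps(4) by (simp add: \<omega>_def)
  \<comment> \<open>The \<open>max 0\<close> keeps the last coordinate in [0, 1] on the first half
    too, so the second branch is continuous on the whole product.\<close>
  define h where "h q = (if snd q \<le> 1/2 then \<omega> (snd q) else g ((fst q)(j := max 0 (2 * snd q - 1))))"
    for q :: "(nat \<Rightarrow> real) \<times> real"
  have time: "continuous_map ?T euclideanreal snd"
    using continuous_map_snd by (rule continuous_map_into_fulltopology)
  have h_cont: "continuous_map ?T Z h"
    unfolding h_def
  proof (rule continuous_map_cases_le[OF time])
    show "continuous_map (subtopology ?T {q \<in> topspace ?T. snd q \<le> 1/2}) Z (\<lambda>q. \<omega> (snd q))"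
      by (intro continuous_map_from_subtopology \<omega>_cont continuous_map_snd)
    have "continuous_map ?T unit_interval (\<lambda>q. max 0 (2 * snd q - 1))"
      unfolding continuous_map_into_unit_interval by (auto intro!: continuous_intros time)
    then show "continuous_map (subtopology ?T {q \<in> topspace ?T. 1/2 \<le> snd q}) Z
        (\<lambda>q. g ((fst q)(j := max 0 (2 * snd q - 1))))"
      by (intro continuous_map_from_subtopology continuous_map_comp[OF g_cont]
          continuous_map_cube_snoc continuous_map_fst)
    show "\<omega> (snd q) = g ((fst q)(j := max 0 (2 * snd q - 1)))"
      if "q \<in> topspace ?T" "snd q = 1/2" for q
    proof -
      have "(fst q)(j := 0) \<in> cube_boundary (Suc j)"
        using that(1) by (subst cube_boundary_snoc) auto
      then show ?thesis using that(2) g_bd \<omega>_end by simp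
    qed
  qed simp
  define \<phi> where "\<phi> t = (fst e, \<lambda>s\<in>{0..1}. h (t, s))" for t
  define \<epsilon> where "\<epsilon> = (fst e, \<lambda>s\<in>{0..1}. \<omega> s)"
  have \<phi>: "\<phi> \<in> maps_rel_boundary j ?F \<epsilon>"
    unfolding maps_rel_boundary_def
  proof (intro CollectI conjI ballI)
    show "continuous_map (cube j) ?F \<phi>"
      unfolding \<phi>_def
    proof (rule continuous_map_into_homotopy_fiber[OF _ h_cont])
      show "continuous_map (cube j) X (\<lambda>t. fst e)"
        using e_simps(1) by simp
      show "h (t, 0) = p (fst e)" for t
        using e_simps(3) by (simp add: h_def \<omega>_def)
      show "h (t, 1) = z" if "t \<in> topspace (cube j)" for t
        using g_bd cube_boundary_snoc[OF that, of 1] by (simp add: h_def)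
    qed
    fix t assume t: "t \<in> cube_boundary j"
    have "h (t, s) = \<omega> s" if s: "s \<in> {0..1}" for s
    proof -
      have "t(j := max 0 (2 * s - 1)) \<in> cube_boundary (Suc j)"
        using t s cube_boundary_subset by (subst cube_boundary_snoc) auto
      then have "g (t(j := max 0 (2 * s - 1))) = z" by (rule g_bd)
      moreover have "\<omega> s = z" if "\<not> s \<le> 1/2"
        using that by (intro \<omega>_end) simp
      ultimately show ?thesis
        unfolding h_def fst_conv snd_conv by argo
    qed
    then show "\<phi> t = \<epsilon>" by (auto simp: \<phi>_def \<epsilon>_def)
  qed
  have "continuous_map unit_interval Z \<omega>"
    using \<omega>_cont[of unit_interval "\<lambda>s. s"] by simp
  then have \<epsilon>: "\<epsilon> \<in> topspace ?F"
    unfolding \<epsilon>_def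
    by (rule homotopy_fiberI[OF e_simps(1)]) (use e_simps in \<open>auto simp: \<omega>_def\<close>)
  have "(\<phi>, \<lambda>_. \<epsilon>) \<in> homotopy_rel_boundary j ?F \<epsilon>"
    by (rule null_homotopic_rel_boundary[OF conn sing[OF _ \<epsilon>] \<epsilon> \<phi>])
  then obtain L where L: "continuous_map (prod_topology unit_interval (cube j)) ?F L"
    and L0: "\<And>t. L (0, t) = \<phi> t" and L1: "\<And>t. L (1, t) = \<epsilon>"
    and L_bd: "\<And>u t. \<lbrakk>u \<in> {0..1}; t \<in> cube_boundary j\<rbrakk> \<Longrightarrow> L (u, t) = \<epsilon>"
    by (elim homotopy_rel_boundaryE) auto
  note L_ends = fiber_path_endpoints[OF subsetD[OF continuous_map_image_subset_topspace[OF L]]]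
  let ?init = "\<lambda>t. restrict t {..<j}"
  define G where "G t = fst (L (t j, ?init t))" for t
  \<comment> \<open>In the (path parameter, contraction parameter) square, \<open>K (u, _)\<close> runs along the segment from
    \<open>(\<alpha> u, 0)\<close> to \<open>(\<beta> u, \<beta>' u)\<close>: at \<open>u = 0\<close> this is the side of starting points, which gives \<open>p \<circ> G\<close>,
    and at \<open>u = 1\<close> it is the half \<open>[1/2, 1] \<times> {0}\<close> of the initial side, which gives \<open>g\<close>.\<close>
  define \<alpha> \<beta> \<beta>' :: "real \<Rightarrow> real"
    where "\<alpha> s = min s (1/2)" and "\<beta> s = min 1 (max s (2 * s - 1/2))" and "\<beta>' s = min 1 (4 - 4 * s)" for s
  define K where "K q = snd (L ((1 - snd q j) * 0 + snd q j * \<beta>' (fst q), ?init (snd q)))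
      ((1 - snd q j) * \<alpha> (fst q) + snd q j * \<beta> (fst q))" for q
  let ?U = "prod_topology unit_interval (cube (Suc j))"
  have init: "continuous_map (cube (Suc j)) (cube j) ?init"
    by (rule continuous_map_cube_init) simp
  have h_early: "h (t, s) = \<omega> s" if "s \<le> 1/2" for t s
    using that by (simp add: h_def)
  show ?thesis
  proof
    show "G \<in> maps_rel_boundary (Suc j) X (fst e)"
      unfolding maps_rel_boundary_def
    proof (intro CollectI conjI ballI)
      show "continuous_map (cube (Suc j)) X G"
        unfolding G_def
        by (intro continuous_map_comp_pair[OF continuous_map_fiber_point[OF L]]
            continuous_map_cube_proj[OF lessI] init)
      fix t assume t: "t \<in> cube_boundary (Suc j)"
      then have "t j \<in> {0..1}" using cube_boundary_subset cube_last_in by blast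
      then show "G t = fst e"
        using cube_boundary_cases[OF t] L_bd[of "t j" "?init t"]
        by (auto simp: G_def L0 L1 \<phi>_def \<epsilon>_def)
    qed
    have time': "continuous_map ?U euclideanreal fst"
      using continuous_map_fst by (rule continuous_map_into_fulltopology)
    have "continuous_map ?U unit_interval (\<lambda>q. \<alpha> (fst q))"
      "continuous_map ?U unit_interval (\<lambda>q. \<beta> (fst q))"
      "continuous_map ?U unit_interval (\<lambda>q. \<beta>' (fst q))"
      unfolding continuous_map_into_unit_interval \<alpha>_def \<beta>_def \<beta>'_def
      by (auto intro!: continuous_intros time' simp: le_max_iff_disj)
    note square = this
    have last: "continuous_map ?U unit_interval (\<lambda>q. snd q j)"
      by (rule continuous_map_comp[OF continuous_map_cube_proj[OF lessI] continuous_map_snd])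
    show "continuous_map ?U Z K"
      unfolding K_def
    proof (rule continuous_map_comp_pair[OF continuous_map_fiber_path[OF L], unfolded fst_conv snd_conv])
      show "continuous_map ?U (prod_topology unit_interval (cube j))
          (\<lambda>q. ((1 - snd q j) * 0 + snd q j * \<beta>' (fst q), ?init (snd q)))"
        by (intro continuous_map_pairedI continuous_map_unit_interval_convex last square
            continuous_map_comp[OF init continuous_map_snd]) simp
      show "continuous_map ?U unit_interval (\<lambda>q. (1 - snd q j) * \<alpha> (fst q) + snd q j * \<beta> (fst q))"
        by (intro continuous_map_unit_interval_convex last square)
    qed
    fix t :: "nat \<Rightarrow> real"
    show "K (0, t) = p (G t)" if t: "t \<in> topspace (cube (Suc j))"
    proof -
      have "(t j, ?init t) \<in> topspace (prod_topology unit_interval (cube j))"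
        using cube_last_in[OF t] cube_init_in[OF t] by simp
      then have "snd (L (t j, ?init t)) 0 = p (fst (L (t j, ?init t)))"
        by (intro L_ends(3)) blast
      then show ?thesis by (simp add: K_def G_def \<alpha>_def \<beta>_def \<beta>'_def)
    qed
    show "K (1, t) = g t" if t: "t \<in> topspace (cube (Suc j))"
    proof -
      note r = cube_last_in[OF t]
      have "K (1, t) = snd (\<phi> (?init t)) ((1 + t j) / 2)"
        by (simp add: K_def L0 \<alpha>_def \<beta>_def \<beta>'_def field_simps)
      also have "\<dots> = h (?init t, (1 + t j) / 2)"
        using r by (simp add: \<phi>_def)
      also have "\<dots> = g t"
      \<comment> \<open>At \<open>t j = 0\<close> the parameter is 1/2, which still falls under the
        first branch of \<open>h\<close>; both branches are \<open>z\<close> there.\<close>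
      proof (cases "t j = 0")
        case True
        then have "t \<in> cube_boundary (Suc j)"
          using t unfolding in_cube_boundary_iff by blast
        then show ?thesis using True \<omega>_end g_bd by (simp add: h_def)
      next
        case False
        then have "max 0 (2 * ((1 + t j) / 2) - 1) = t j" "\<not> (1 + t j) / 2 \<le> 1/2"
          using r by (auto simp: field_simps)
        then show ?thesis by (simp add: h_def cube_snoc_init[OF t])
      qed
      finally show ?thesis .
    qed
    fix u :: real
    show "K (u, t) = snd e (min 1 (2 * u))" if u: "u \<in> {0..1}" and t: "t \<in> cube_boundary (Suc j)"
    proof -
      have t': "t \<in> topspace (cube (Suc j))" using t cube_boundary_subset by blast
      note r = cube_last_in[OF t'] and init_t = cube_init_in[OF t']
      have b: "\<alpha> u \<in> {0..1}" "\<beta> u \<in> {0..1}" "\<beta>' u \<in> {0..1}"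
        using u by (auto simp: \<alpha>_def \<beta>_def \<beta>'_def le_max_iff_disj)
      have "min 1 (2 * \<alpha> u) = min 1 (2 * u)"
        by (auto simp: \<alpha>_def min_def)
      then have \<omega>\<alpha>: "\<omega> (\<alpha> u) = \<omega> u"
        by (simp add: \<omega>_def)
      \<comment> \<open>The start of the segment moves at contraction parameter 0. Its end moves at
        contraction parameter 1 until \<open>u = 3/4\<close>, then along the side of path ends. Over
        the boundary of \<open>cube j\<close>, \<open>L\<close> is constantly
        \<open>\<epsilon>\<close>.\<close>
      consider "t j = 0" | "t j = 1" "u \<le> 3/4" | "t j = 1" "u \<ge> 3/4"
        | "?init t \<in> cube_boundary j"
        using cube_boundary_cases[OF t] by linarith
      then have "K (u, t) = \<omega> u"
      proof cases
        case 1
        then have "K (u, t) = h (?init t, \<alpha> u)"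
          using b by (simp add: K_def L0 \<phi>_def)
        then show ?thesis using h_early \<omega>\<alpha> by (simp add: \<alpha>_def)
      next
        case 2
        then have "\<beta>' u = 1" by (simp add: \<beta>'_def)
        then have "K (u, t) = \<omega> (\<beta> u)"
          using b 2 by (simp add: K_def L1 \<epsilon>_def)
        moreover have "\<omega> (\<beta> u) = \<omega> u"
        proof (cases "u \<le> 1/2")
          case True
          then show ?thesis by (simp add: \<beta>_def max_absorb1)
        next
          case False
          then show ?thesis using \<omega>_end[of u] \<omega>_end[of "\<beta> u"] by (auto simp: \<beta>_def)
        qed
        ultimately show ?thesis by simp
      next
        case 3
        then have "\<beta> u = 1" by (auto simp: \<beta>_def)
        then have "K (u, t) = snd (L (\<beta>' u, ?init t)) 1"
          using 3 by (simp add: K_def)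
        also have "\<dots> = z"
          by (rule L_ends(4)) (use b init_t in auto)
        finally show ?thesis using \<omega>_end[of u] 3 by simp
      next
        case 4
        let ?s = "(1 - t j) * \<alpha> u + t j * \<beta> u"
        have s: "?s \<in> {0..1}"
          using r b by (auto intro!: convex_bound_le)
        have "t j * \<beta>' u \<in> {0..1}"
          using r b by (auto simp: mult_le_one)
        then have "K (u, t) = \<omega> ?s"
          using 4 L_bd s by (simp add: K_def \<epsilon>_def)
        moreover have "\<omega> ?s = \<omega> u"
        proof (cases "u \<le> 1/2")
          case True
          then have "\<alpha> u = u" "\<beta> u = u" by (auto simp: \<alpha>_def \<beta>_def)
          then show ?thesis by (simp add: algebra_simps)
        next
          case False
          then have "- \<alpha> u \<le> - (1/2)" "- \<beta> u \<le> - (1/2)" by (auto simp: \<alpha>_def \<beta>_def)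
          then have "(1 - t j) * (- \<alpha> u) + t j * (- \<beta> u) \<le> - (1/2)"
            using r by (intro convex_bound_le) auto
          then have "?s \<ge> 1/2" by simp
          then show ?thesis using \<omega>_end False by simp
        qed
        ultimately show ?thesis by simp
      qed
      then show ?thesis by (simp add: \<omega>_def)
    qed
  qed
qed

text \<open>With \<open>e\<close> fixed all lifts share one trace, so the class of a chosen lift to
  \<open>X\<close> determines the class of \<open>g\<close>.\<close>

lemma finite_homotopy_group_of_trivial_fiber:
  assumes p: "continuous_map X Z p"
    and e: "e \<in> topspace (homotopy_fiber X Z p z)"
    and conn: "j = 0 \<Longrightarrow> path_connected_space (homotopy_fiber X Z p z)"
    and sing: "\<And>e. \<lbrakk>j > 0; e \<in> topspace (homotopy_fiber X Z p z)\<rbrakk> \<Longrightarrow>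
      is_singleton (homotopy_group j (homotopy_fiber X Z p z) e)"
    and fin: "finite (homotopy_group (Suc j) X (fst e))"
  shows "finite (homotopy_group (Suc j) Z z)"
proof -
  note e_simps = fiber_path_endpoints[OF e]
  let ?\<omega> = "\<lambda>u. snd e (min 1 (2 * u))"
  let ?lift = "\<lambda>g G K. G \<in> maps_rel_boundary (Suc j) X (fst e) \<and>
    continuous_map (prod_topology unit_interval (cube (Suc j))) Z K \<and>
    (\<forall>u\<in>{0..1}. \<forall>t\<in>cube_boundary (Suc j). K (u, t) = ?\<omega> u) \<and>
    (\<forall>t\<in>topspace (cube (Suc j)). K (0, t) = p (G t)) \<and>
    (\<forall>t\<in>topspace (cube (Suc j)). K (1, t) = g t)"
  have "\<exists>G K. ?lift g G K" if "g \<in> maps_rel_boundary (Suc j) Z z" for g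
    using free_lift_of_trivial_fiber[OF p e conn sing that] by metis
  then obtain \<Phi> \<Psi> where lift: "\<And>g. g \<in> maps_rel_boundary (Suc j) Z z \<Longrightarrow> ?lift g (\<Phi> g) (\<Psi> g)"
    by metis
  show ?thesis
  proof (rule finite_homotopy_group_transfer[OF fin, where \<phi> = \<Phi>])
    show "\<Phi> g \<in> maps_rel_boundary (Suc j) X (fst e)" if "g \<in> maps_rel_boundary (Suc j) Z z" for g
      using lift[OF that] by blast
    fix g h
    assume g: "g \<in> maps_rel_boundary (Suc j) Z z" and h: "h \<in> maps_rel_boundary (Suc j) Z z"
      and gh: "(\<Phi> g, \<Phi> h) \<in> homotopy_rel_boundary (Suc j) X (fst e)"
    have "(g, h) \<in> homotopy_rel_boundary (Suc j) Z (?\<omega> 1)"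
    proof (rule homotopic_if_free_lifts_homotopic[where \<omega> = ?\<omega> and K = "\<Psi> g" and K' = "\<Psi> h", OF p _ _ _ _ _ _ _ _ gh])
      show "?\<omega> 0 = p (fst e)" using e_simps by simp
    qed (use lift[OF g] lift[OF h] in \<open>blast+\<close>)
    then show "(g, h) \<in> homotopy_rel_boundary (Suc j) Z z"
      using e_simps by simp
  qed
qed

subsection \<open>Path components\<close>

lemma path_components_of_eq:
  assumes "path_component_of X x y"
  shows "path_component_of_set X x = path_component_of_set X y"
  using assms by (simp add: path_component_of_equiv)

text \<open>A point of the fiber over \<open>z\<close> carries a path from the image of
  \<open>p\<close> to \<open>z\<close>, so \<open>p\<close> is surjective on path
  components.\<close>

lemma finite_path_components_of_codomain:
  assumes p: "continuous_map X Z p"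
    and fibers: "\<And>z. z \<in> topspace Z \<Longrightarrow> topspace (homotopy_fiber X Z p z) \<noteq> {}"
    and fin: "finite (path_components_of X)"
  shows "finite (path_components_of Z)"
proof -
  let ?k = "\<lambda>x. path_component_of_set Z (p x)"
  have "finite (?k ` topspace X)"
  proof (rule finite_image_factor[OF fin[unfolded path_components_of_def]])
    fix x y assume xy: "x \<in> topspace X" "y \<in> topspace X"
      and eq: "path_component_of_set X x = path_component_of_set X y"
    have "path_component_of X y y"
      using xy by (simp add: path_component_of_refl)
    then have "path_component_of X x y"
      using eq by blast
    then obtain \<gamma> where "pathin X \<gamma>" "\<gamma> 0 = x" "\<gamma> 1 = y"
      unfolding path_component_of_def by blast
    then have "path_component_of Z (p x) (p y)"
      unfolding path_component_of_def using pathin_compose[OF _ p] by (intro exI[of _ "p \<circ> \<gamma>"]) auto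
    then show "?k x = ?k y" by (rule path_components_of_eq)
  qed
  moreover have "path_components_of Z \<subseteq> ?k ` topspace X"
  proof
    fix C assume "C \<in> path_components_of Z"
    then obtain z where z: "z \<in> topspace Z" and C: "C = path_component_of_set Z z"
      by (auto simp: path_components_of_def)
    obtain e where e: "e \<in> topspace (homotopy_fiber X Z p z)"
      using fibers[OF z] by blast
    have "path_component_of Z (p (fst e)) z"
      unfolding path_component_of_def pathin_def
      using fiber_path_endpoints[OF e] by (intro exI[of _ "snd e"]) auto
    then have "C = ?k (fst e)"
      unfolding C by (rule path_components_of_eq[symmetric])
    then show "C \<in> ?k ` topspace X"
      using fiber_path_endpoints(1)[OF e] by blast
  qed
  ultimately show ?thesis by (rule rev_finite_subset)
qed

text \<open>Path connected fibers make \<open>q\<close> injective on path components.\<close>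

lemma finite_path_components_of_domain:
  assumes q: "continuous_map Z Y q"
    and fibers: "\<And>y. y \<in> topspace Y \<Longrightarrow> path_connected_space (homotopy_fiber Z Y q y)"
    and fin: "finite (path_components_of Y)"
  shows "finite (path_components_of Z)"
proof -
  let ?h = "\<lambda>z. path_component_of_set Y (q z)"
  have qz: "q z \<in> topspace Y" if "z \<in> topspace Z" for z
    using that q by (auto simp: continuous_map_def)
  have "finite (?h ` topspace Z)"
    by (rule finite_subset[OF _ fin]) (use qz in \<open>auto simp: path_components_of_def\<close>)
  then show ?thesis
    unfolding path_components_of_def
  proof (rule finite_image_factor)
    fix z w assume z: "z \<in> topspace Z" and w: "w \<in> topspace Z" and eq: "?h z = ?h w"
    have "path_component_of Y (q w) (q w)"
      using qz[OF w] by (simp add: path_component_of_refl)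
    then have "path_component_of Y (q z) (q w)"
      using eq by blast
    then obtain \<gamma> where \<gamma>: "continuous_map unit_interval Y \<gamma>" "\<gamma> 0 = q z" "\<gamma> 1 = q w"
      unfolding path_component_of_def pathin_def by blast
    \<comment> \<open>\<open>z\<close> with \<open>\<gamma>\<close> and \<open>w\<close> with the
      constant path lie in one fiber; a path joining them there projects to a path from
      \<open>z\<close> to \<open>w\<close>.\<close>
    let ?F = "homotopy_fiber Z Y q (q w)"
    have "(z, restrict \<gamma> {0..1}) \<in> topspace ?F"
      by (rule homotopy_fiberI) (use z \<gamma> in auto)
    moreover have "(w, \<lambda>s\<in>{0..1}. q w) \<in> topspace ?F"
      by (rule homotopy_fiberI) (use w qz[OF w] in auto)
    ultimately obtain \<delta> where \<delta>: "pathin ?F \<delta>" "\<delta> 0 = (z, restrict \<gamma> {0..1})"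
        "\<delta> 1 = (w, \<lambda>s\<in>{0..1}. q w)"
      using fibers[OF qz[OF w]] unfolding path_connected_space_def by blast
    have "path_component_of Z z w"
      unfolding path_component_of_def pathin_def
      using continuous_map_fiber_point[OF \<delta>(1)[unfolded pathin_def]] \<delta>(2,3)
      by (intro exI[of _ "\<lambda>s. fst (\<delta> s)"]) auto
    then show "path_component_of_set Z z = path_component_of_set Z w"
      by (rule path_components_of_eq)
  qed
qed

subsection \<open>Finiteness of the intermediate space\<close>

theorem proposition2p2p5:
  fixes n :: int
    and X :: "'a topology" and Y :: "'b topology" and Z :: "'c topology"
    and f :: "'a \<Rightarrow> 'b" and p :: "'a \<Rightarrow> 'c" and q :: "'c \<Rightarrow> 'b"
  assumes "n \<ge> -2"
    and "pi_finite X" and "pi_finite Y"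
    and "continuous_map X Y f"
    and "connected_truncated_factorization n X Z Y f p q"
  shows "pi_finite Z"
proof -
  have p: "continuous_map X Z p"
    and p_fibers: "\<And>z. z \<in> topspace Z \<Longrightarrow> connected_space_at_level n (homotopy_fiber X Z p z)"
    and q: "continuous_map Z Y q"
    and q_fibers: "\<And>y. y \<in> topspace Y \<Longrightarrow> truncated_space n (homotopy_fiber Z Y q y)"
    using assms(5)
    by (auto simp: connected_truncated_factorization_def connected_map_at_level_def truncated_map_def)
  have qz: "q z \<in> topspace Y" if "z \<in> topspace Z" for z
    using that q by (auto simp: continuous_map_def)
  have q_inj: "(g, h) \<in> homotopy_rel_boundary i Z z"
    if i: "i > 0" "int i > n" and z: "z \<in> topspace Z"
      and gh: "g \<in> maps_rel_boundary i Z z" "h \<in> maps_rel_boundary i Z z"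
        "(q \<circ> g, q \<circ> h) \<in> homotopy_rel_boundary i Y (q z)" for i g h z
  proof (rule homotopy_rel_boundary_of_trivial_fiber[OF q z i(1) _ gh])
    have "(z, \<lambda>s\<in>{0..1}. q z) \<in> topspace (homotopy_fiber Z Y q (q z))"
      by (rule homotopy_fiberI) (use z qz in auto)
    then show "is_singleton (homotopy_group i (homotopy_fiber Z Y q (q z)) (z, \<lambda>s\<in>{0..1}. q z))"
      using q_fibers[OF qz[OF z]] i unfolding truncated_space_def by blast
  qed
  have "finite (path_components_of Z)"
  \<comment> \<open>At \<open>n = -2\<close> the fibers of \<open>q\<close> are path connected; from
    \<open>n = -1\<close> on those of \<open>p\<close> are nonempty.\<close>
  proof (cases "n = -2")
    case True
    then show ?thesis
      using finite_path_components_of_domain[OF q] q_fibers assms(3)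
      by (simp add: truncated_space_def pi_finite_def)
  next
    case False
    then show ?thesis
      using finite_path_components_of_codomain[OF p] p_fibers assms(1,2)
      by (simp add: connected_space_at_level_def pi_finite_def)
  qed
  moreover have "finite (homotopy_group i Z z)" if i: "i > 0" and z: "z \<in> topspace Z" for i z
  proof (cases "int i > n")
    case True
    have "finite (homotopy_group i Y (q z))"
      using assms(3) i qz[OF z] by (simp add: pi_finite_def)
    then show ?thesis
      by (rule finite_homotopy_group_transfer[where \<phi> = "(\<circ>) q"])
        (use q_inj[OF i True z] maps_rel_boundary_compose[OF _ q] in blast)+
  next
    \<comment> \<open>Now \<open>0 < i \<le> n\<close>, so the fibers of \<open>p\<close> are
      nonempty and path connected, which serves \<open>j = 0\<close>; for \<open>j > 0\<close> their
      groups in degree \<open>j = i - 1\<close> are trivial.\<close>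
    case False
    obtain j where j: "i = Suc j" using i gr0_implies_Suc by blast
    note fib = p_fibers[OF z, unfolded connected_space_at_level_def]
    obtain e where e: "e \<in> topspace (homotopy_fiber X Z p z)"
      using fib False i by fastforce
    show ?thesis
      unfolding j
    proof (rule finite_homotopy_group_of_trivial_fiber[OF p e])
      show "path_connected_space (homotopy_fiber X Z p z)"
        using fib False i by simp
      show "is_singleton (homotopy_group j (homotopy_fiber X Z p z) e)"
        if "j > 0" "e \<in> topspace (homotopy_fiber X Z p z)" for e
        using fib False that unfolding j by simp
      show "finite (homotopy_group (Suc j) X (fst e))"
        using assms(2) fiber_path_endpoints(1)[OF e] by (simp add: pi_finite_def)
    qed
  qed
  moreover have "\<exists>k\<ge>-2. truncated_space k Z"
  proof -
    obtain k where k: "truncated_space k Y"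
      using assms(3) by (auto simp: pi_finite_def)
    \<comment> \<open>A level of at least 0 demands neither nonemptiness nor connectedness of
      \<open>Z\<close>. Above \<open>k\<close> the groups of \<open>Y\<close> are trivial, and above
      \<open>n\<close> the map \<open>q\<close> is injective on homotopy groups.\<close>
    have "is_singleton (homotopy_group i Z z)"
      if i: "i > 0" "int i > max 0 (max k n)" and z: "z \<in> topspace Z" for i z
    proof (rule is_singleton_homotopy_group[OF z])
      fix g h assume gh: "g \<in> maps_rel_boundary i Z z" "h \<in> maps_rel_boundary i Z z"
      have "is_singleton (homotopy_group i Y (q z))"
        using k i qz[OF z] by (simp add: truncated_space_def)
      then have null: "(q \<circ> u, \<lambda>_. q z) \<in> homotopy_rel_boundary i Y (q z)"
        if "u \<in> maps_rel_boundary i Z z" for u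
        using null_homotopic_rel_boundary[OF _ _ qz[OF z] maps_rel_boundary_compose[OF that q]] i(1)
        by simp
      have "(q \<circ> g, q \<circ> h) \<in> homotopy_rel_boundary i Y (q z)"
        using null[OF gh(1)] null[OF gh(2)] equiv_homotopy_rel_boundary[of i Y "q z"]
        by (meson equivE symE transE)
      then show "(g, h) \<in> homotopy_rel_boundary i Z z"
        using q_inj i gh z by simp
    qed
    then have "truncated_space (max 0 (max k n)) Z"
      by (simp add: truncated_space_def)
    then show ?thesis by (intro exI[of _ "max 0 (max k n)"]) simp
  qed
  ultimately show ?thesis
    by (simp add: pi_finite_def)
qed

end
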